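(* Let $q\ge 3$ be a prime power and let $X\subset\mathbb{P}^3(\mathbb{F}_q)$ be a hyperbolic quadric. The code $C_2(X)$ is an $[n,k,d]_q$-code with $$n=(q+1)^2,\qquad k=9,\qquad d=(q-1)^2.$$
   Context: A quadric in $\mathbb{P}^3(\mathbb{F}_q)$ is the zero set $Z(f)$ of a nonzero form $f$ of degree 2 in $x_0,\dots,x_3$ over $\mathbb{F}_q$. It is non-degenerate if it has rank 4, the rank being the smallest number of indeterminates appearing in $f$ under any linear change of coordinates. A hyperbolic quadric is a non-degenerate quadric with $(q+1)^2$ points over $\mathbb{F}_q$. Let $F$ be the $\mathbb{F}_q$-vector space of forms of degree 2 in $x_0,\dots,x_3$ over $\mathbb{F}_q$ (including $0$). Each point $x\in\mathbb{P}^3(\mathbb{F}_q)$ is represented by its unique homogeneous coordinate vector whose first nonzero coordinate equals $1$. The functional code $C_2(X)$ is the image of the linear map $c:F\to\mathbb{F}_q^{|X|}$, $c(f)=(f(x_0,\dots,x_3))_{x\in X}$. An $[n,k,d]_q$-code is a linear code over $\mathbb{F}_q$ of length $n$, dimension $k$ and minimum distance $d$. *)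

theory Defs
  imports
    "HOL-Analysis.Analysis"
    "HOL-Library.Poly_Mapping"
    "HOL-Library.Function_Algebras"
begin

text \<open>
  The indeterminates $x_0,\dots,x_3$ are indexed by the four-element type \<open>4\<close>, whose
  elements are \<open>0 < 1 < 2 < 3\<close>.  Polynomials are formal objects (finitely supported families
  of coefficients indexed by exponent vectors), not polynomial functions.
\<close>

type_synonym 'a poly4 = "(4 \<Rightarrow>\<^sub>0 nat) \<Rightarrow>\<^sub>0 'a"

definition is_form :: "nat \<Rightarrow> ('a::field) poly4 \<Rightarrow> bool"
  where "is_form d f \<longleftrightarrow>
    (\<forall>m \<in> Poly_Mapping.keys f. (\<Sum>i\<in>UNIV. Poly_Mapping.lookup m i) = d)"

definition eval4 :: "('a::field) poly4 \<Rightarrow> 'a ^ 4 \<Rightarrow> 'a"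
  where "eval4 f v =
    (\<Sum>m \<in> Poly_Mapping.keys f.
       Poly_Mapping.lookup f m * (\<Prod>i\<in>UNIV. (v $ i) ^ Poly_Mapping.lookup m i))"

definition const4 :: "'a::field \<Rightarrow> 'a poly4"
  where "const4 c = Poly_Mapping.single 0 c"

definition var4 :: "4 \<Rightarrow> ('a::field) poly4"
  where "var4 i = Poly_Mapping.single (Poly_Mapping.single i 1) 1"

text \<open>The substitution $x_i \mapsto \sum_j A_{ij} x_j$; a linear change of coordinates when
  the matrix \<open>A\<close> is invertible.\<close>

definition lin_subst :: "('a::field) ^ 4 ^ 4 \<Rightarrow> 'a poly4 \<Rightarrow> 'a poly4"
  where "lin_subst A f =
    (\<Sum>m \<in> Poly_Mapping.keys f.
       const4 (Poly_Mapping.lookup f m) *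
       (\<Prod>i\<in>UNIV. (\<Sum>j\<in>UNIV. const4 (A $ i $ j) * var4 j) ^ Poly_Mapping.lookup m i))"

definition indets :: "('a::field) poly4 \<Rightarrow> 4 set"
  where "indets f = (\<Union>m \<in> Poly_Mapping.keys f. Poly_Mapping.keys m)"

definition form_rank :: "('a::field) poly4 \<Rightarrow> nat"
  where "form_rank f = (LEAST r. \<exists>A. invertible A \<and> r = card (indets (lin_subst A f)))"

text \<open>Projective points are the one-dimensional subspaces of the coordinate space.\<close>

type_synonym 'a point3 = "('a ^ 4) set"

definition proj_space3 :: "('a::field) point3 set"
  where "proj_space3 = {vec.span {v} | v. v \<noteq> 0}"

definition coord_rep :: "('a::field) point3 \<Rightarrow> 'a ^ 4"
  where "coord_rep p = (THE v. v \<in> p \<and> (\<exists>i. v $ i = 1 \<and> (\<forall>j<i. v $ j = 0)))"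

definition zero_set :: "('a::field) poly4 \<Rightarrow> 'a point3 set"
  where "zero_set f = {p \<in> proj_space3. \<forall>v\<in>p. v \<noteq> 0 \<longrightarrow> eval4 f v = 0}"

text \<open>Non-degeneracy is a property of a defining form; hence the existential quantifier.\<close>

definition nondegenerate_quadric :: "('a::field) point3 set \<Rightarrow> bool"
  where "nondegenerate_quadric X \<longleftrightarrow>
    (\<exists>f. f \<noteq> 0 \<and> is_form 2 f \<and> form_rank f = 4 \<and> X = zero_set f)"

definition hyperbolic_quadric :: "('a::{field,finite}) point3 set \<Rightarrow> bool"
  where "hyperbolic_quadric X \<longleftrightarrow>
    nondegenerate_quadric X \<and> card X = (CARD('a) + 1)\<^sup>2"

text \<open>
  A word with coordinates indexed by a finite set \<open>I\<close> is a function vanishing outside \<open>I\<close>, so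
  that these functions form a copy of the coordinate space over \<open>I\<close>.
\<close>

definition word_scale :: "'a::field \<Rightarrow> ('p \<Rightarrow> 'a) \<Rightarrow> ('p \<Rightarrow> 'a)"
  where "word_scale c w = (\<lambda>x. c * w x)"

interpretation word: vector_space word_scale
  by unfold_locales (auto simp: word_scale_def fun_eq_iff algebra_simps)

definition words_on :: "'p set \<Rightarrow> ('p \<Rightarrow> 'a::field) set"
  where "words_on I = {w. \<forall>x. x \<notin> I \<longrightarrow> w x = 0}"

definition hamming_dist :: "'p set \<Rightarrow> ('p \<Rightarrow> 'a) \<Rightarrow> ('p \<Rightarrow> 'a) \<Rightarrow> nat"
  where "hamming_dist I u w = card {x \<in> I. u x \<noteq> w x}"

definition min_dist :: "'p set \<Rightarrow> ('p \<Rightarrow> 'a) set \<Rightarrow> nat"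
  where "min_dist I C = Min {hamming_dist I u w | u w. u \<in> C \<and> w \<in> C \<and> u \<noteq> w}"

text \<open>\<open>C\<close> is an $[n,k,d]$-code over the field \<open>'a\<close> with coordinates indexed by \<open>I\<close>.\<close>

definition is_code :: "'p set \<Rightarrow> ('p \<Rightarrow> 'a::field) set \<Rightarrow> nat \<Rightarrow> nat \<Rightarrow> nat \<Rightarrow> bool"
  where "is_code I C n k d \<longleftrightarrow>
    finite I \<and> C \<subseteq> words_on I \<and> word.subspace C \<and>
    card I = n \<and> word.dim C = k \<and> min_dist I C = d"

definition code_map :: "('a::field) point3 set \<Rightarrow> 'a poly4 \<Rightarrow> ('a point3 \<Rightarrow> 'a)"
  where "code_map X f = (\<lambda>x. if x \<in> X then eval4 f (coord_rep x) else 0)"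

definition functional_code :: "nat \<Rightarrow> ('a::field) point3 set \<Rightarrow> ('a point3 \<Rightarrow> 'a) set"
  where "functional_code d X = code_map X ` {f. is_form d f}"

end

(* A non-degenerate quadric with a point contains a hyperbolic pair u, w. If the form were anisotropic
   on the orthogonal complement of u, w, every point other than <w> would be <u - Q(z) w + z> for a
   unique z in that complement, so the quadric would have at most q^2 + 1 points; hence a quadric with
   (q + 1)^2 points has the equation y1 y4 = y2 y3 and is the image of the Segre embedding of a product
   of two projective lines. Quadratic forms restrict to exactly the forms of bidegree (2,2) on this
   product, a space with 9 monomials. If such a form c is nonzero, at most two of the lines {s} x P^1
   lie in its zero set and the others meet it in at most two points, so c has at most
   2 (q + 1) + 2 (q - 1) = 4 q zeros, with equality for c = s0 s1 t0 t1. *)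

theory Submission
  imports Defs
begin

subsection \<open>Quaternary forms and their values\<close>

text \<open>Additivity needs several polynomials evaluated over one common finite set of monomials;
  the surplus monomials carry coefficient 0.\<close>

lemma eval4_superset:
  assumes "finite S" "Poly_Mapping.keys f \<subseteq> S"
  shows "eval4 f v = (\<Sum>m\<in>S. Poly_Mapping.lookup f m * (\<Prod>i\<in>UNIV. (v $ i) ^ Poly_Mapping.lookup m i))"
  unfolding eval4_def
  by (rule sum.mono_neutral_left) (use assms in \<open>auto simp: in_keys_iff\<close>)

lemma eval4_zero: "eval4 0 v = 0"
  by (simp add: eval4_def)

lemma eval4_single:
  "eval4 (Poly_Mapping.single m c) v = c * (\<Prod>i\<in>UNIV. (v $ i) ^ Poly_Mapping.lookup m i)"
  by (subst eval4_superset[where S = "{m}"]) auto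

lemma eval4_add: "eval4 (f + g) v = eval4 f v + eval4 g v"
proof -
  let ?S = "Poly_Mapping.keys f \<union> Poly_Mapping.keys g"
  have "eval4 h v = (\<Sum>m\<in>?S. Poly_Mapping.lookup h m * (\<Prod>i\<in>UNIV. (v $ i) ^ Poly_Mapping.lookup m i))"
    if "h \<in> {f, g, f + g}" for h
    using that keys_add[of f g] by (intro eval4_superset) auto
  then show ?thesis
    by (simp add: lookup_add algebra_simps sum.distrib)
qed

lemma eval4_sum: "eval4 (sum f S) v = (\<Sum>i\<in>S. eval4 (f i) v)"
  by (induction S rule: infinite_finite_induct) (auto simp: eval4_zero eval4_add)

lemma poly_mapping_sum_monomials:
  "f = (\<Sum>m\<in>Poly_Mapping.keys f. Poly_Mapping.single m (Poly_Mapping.lookup f m))"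
  by (rule poly_mapping_eqI) (auto simp: lookup_sum lookup_single when_def in_keys_iff)

text \<open>Both sides are additive in each factor, so it suffices to compare products of two
  monomials, where exponents add.\<close>

lemma eval4_mult: "eval4 (f * g) v = eval4 f v * eval4 g v"
proof -
  have single: "eval4 (Poly_Mapping.single m c * Poly_Mapping.single n d) v =
      eval4 (Poly_Mapping.single m c) v * eval4 (Poly_Mapping.single n d) v" for m n c d
    by (simp add: mult_single eval4_single lookup_add power_add prod.distrib)
  let ?f = "\<Sum>m\<in>Poly_Mapping.keys f. Poly_Mapping.single m (Poly_Mapping.lookup f m)"
  let ?g = "\<Sum>m\<in>Poly_Mapping.keys g. Poly_Mapping.single m (Poly_Mapping.lookup g m)"
  have "eval4 (?f * ?g) v = eval4 ?f v * eval4 ?g v"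
    by (simp only: sum_product eval4_sum single)
  then show ?thesis
    by (simp only: poly_mapping_sum_monomials[symmetric])
qed

lemma eval4_one: "eval4 1 v = 1"
  using eval4_single[of 0 1 v] by simp

lemma eval4_power: "eval4 (f ^ n) v = eval4 f v ^ n"
  by (induction n) (auto simp: eval4_one eval4_mult)

lemma eval4_prod: "eval4 (prod f S) v = (\<Prod>i\<in>S. eval4 (f i) v)"
  by (induction S rule: infinite_finite_induct) (auto simp: eval4_one eval4_mult)

lemma eval4_const4: "eval4 (const4 c) v = c"
  by (simp add: const4_def eval4_single)

lemma eval4_var4: "eval4 (var4 i) v = v $ i"
proof -
  have "(\<Prod>j\<in>UNIV. (v $ j) ^ Poly_Mapping.lookup (Poly_Mapping.single i (1::nat)) j)
      = (\<Prod>j\<in>UNIV. if j = i then v $ j else 1)"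
    by (rule prod.cong) (auto simp: lookup_single when_def)
  then show ?thesis
    by (simp add: var4_def eval4_single)
qed

text \<open>Evaluation respects sums, products and powers, so a substitution acts on values through
  the matrix alone and its expansion need not be inspected.\<close>

lemma eval4_lin_subst: "eval4 (lin_subst A f) v = eval4 f (A *v v)"
  unfolding lin_subst_def eval4_sum eval4_mult eval4_prod eval4_power eval4_const4 eval4_var4
  by (simp add: eval4_def matrix_vector_mult_def)

section \<open>Homogeneity and its preservation under linear substitution\<close>

lemma is_form_zero: "is_form d 0"
  by (simp add: is_form_def)

lemma is_form_add: "is_form d f \<Longrightarrow> is_form d g \<Longrightarrow> is_form d (f + g)"
  unfolding is_form_def using keys_add[of f g] by blast

lemma is_form_sum: "(\<And>i. i \<in> S \<Longrightarrow> is_form d (f i)) \<Longrightarrow> is_form d (sum f S)"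
  by (induction S rule: infinite_finite_induct) (auto simp: is_form_zero is_form_add)

lemma is_form_mult: "is_form c f \<Longrightarrow> is_form d g \<Longrightarrow> is_form (c + d) (f * g)"
  unfolding is_form_def using keys_mult[of f g]
  by (fastforce simp: lookup_add sum.distrib)

lemma is_form_const4: "is_form 0 (const4 c)"
  by (auto simp: is_form_def const4_def)

lemma is_form_var4: "is_form 1 (var4 i)"
  by (auto simp: is_form_def var4_def lookup_single when_def)

lemma is_form_power: "is_form d f \<Longrightarrow> is_form (n * d) (f ^ n)"
proof (induction n)
  case 0
  show ?case using is_form_const4[of 1] by (simp add: const4_def)
next
  case (Suc n)
  then show ?case using is_form_mult[of d f "n * d" "f ^ n"] by simp
qed

lemma is_form_prod:
  "finite S \<Longrightarrow> (\<And>i. i \<in> S \<Longrightarrow> is_form (d i) (f i)) \<Longrightarrow> is_form (sum d S) (prod f S)"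
proof (induction S rule: finite_induct)
  case empty
  show ?case using is_form_const4[of 1] by (simp add: const4_def)
next
  case (insert x S)
  then show ?case by (simp add: is_form_mult)
qed

lemma is_form_lin_subst:
  assumes "is_form d f"
  shows "is_form d (lin_subst A f)"
  unfolding lin_subst_def
proof (rule is_form_sum)
  fix m assume m: "m \<in> Poly_Mapping.keys f"
  have lin: "is_form 1 (\<Sum>j\<in>UNIV. const4 (A $ i $ j) * var4 j)" for i
    using is_form_mult[OF is_form_const4 is_form_var4] by (intro is_form_sum) simp
  have "is_form (\<Sum>i\<in>UNIV. Poly_Mapping.lookup m i)
     (\<Prod>i\<in>UNIV. (\<Sum>j\<in>UNIV. const4 (A $ i $ j) * var4 j) ^ Poly_Mapping.lookup m i)"
    by (rule is_form_prod) (use is_form_power[OF lin] in auto)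
  moreover have "(\<Sum>i\<in>UNIV. Poly_Mapping.lookup m i) = d"
    using assms m by (auto simp: is_form_def)
  ultimately show "is_form d (const4 (Poly_Mapping.lookup f m) *
      (\<Prod>i\<in>UNIV. (\<Sum>j\<in>UNIV. const4 (A $ i $ j) * var4 j) ^ Poly_Mapping.lookup m i))"
    using is_form_mult[OF is_form_const4] by fastforce
qed

section \<open>Monomials of degree two and recovery of coefficients from values\<close>

lemma monomial_degree_Suc:
  fixes m :: "4 \<Rightarrow>\<^sub>0 nat"
  assumes "(\<Sum>i\<in>UNIV. Poly_Mapping.lookup m i) = Suc d"
    and "i \<in> Poly_Mapping.keys m"
  obtains n where "m = Poly_Mapping.single i 1 + n" "(\<Sum>i\<in>UNIV. Poly_Mapping.lookup n i) = d"
proof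
  \<comment> \<open>Exponents are subtracted with truncation at 0; since \<open>i\<close> occurs in
    \<open>m\<close>, the subtraction is exact.\<close>
  let ?n = "m - Poly_Mapping.single i 1"
  show *: "m = Poly_Mapping.single i 1 + ?n"
    using assms(2) by (intro poly_mapping_eqI) (auto simp: lookup_add lookup_minus lookup_single when_def in_keys_iff)
  have "(\<Sum>j\<in>UNIV. Poly_Mapping.lookup m j) = (\<Sum>j\<in>UNIV. if j = i then 1 else 0)
      + (\<Sum>j\<in>UNIV. Poly_Mapping.lookup ?n j)"
    by (subst *) (auto simp: lookup_add sum.distrib lookup_single when_def intro: sum.cong)
  then show "(\<Sum>j\<in>UNIV. Poly_Mapping.lookup ?n j) = d"
    using assms(1) by simp
qed

lemma monomial_degree_2:
  fixes m :: "4 \<Rightarrow>\<^sub>0 nat"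
  assumes "(\<Sum>i\<in>UNIV. Poly_Mapping.lookup m i) = 2" and "i \<in> Poly_Mapping.keys m"
  obtains j where "m = Poly_Mapping.single i 1 + Poly_Mapping.single j 1"
proof -
  obtain n where n: "m = Poly_Mapping.single i 1 + n" "(\<Sum>i\<in>UNIV. Poly_Mapping.lookup n i) = 1"
    using monomial_degree_Suc[of m 1 i] assms by (auto simp: numeral_2_eq_2)
  then obtain j where "j \<in> Poly_Mapping.keys n"
    by (metis in_keys_iff sum.neutral zero_neq_one)
  then obtain k where k: "n = Poly_Mapping.single j 1 + k" "(\<Sum>i\<in>UNIV. Poly_Mapping.lookup k i) = 0"
    using monomial_degree_Suc[of n 0 j] n(2) by auto
  then have "k = 0"
    by (intro poly_mapping_eqI) simp
  then show ?thesis using that n k by simp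
qed

lemma keys_single_add_single:
  "Poly_Mapping.keys (Poly_Mapping.single i (1::nat) + Poly_Mapping.single j 1) = {i, j}"
  by (auto simp: in_keys_iff lookup_add lookup_single when_def split: if_splits)

text \<open>At a 0-1-vector a monomial is 1 if all its indeterminates lie in \<open>S\<close> and 0
  otherwise (exponent 0 contributes 0^0 = 1), so the values of \<open>g\<close> there are partial
  sums of its coefficients.\<close>

lemma eval4_indicator:
  fixes g :: "'a::field poly4"
  shows "eval4 g (\<chi> i. if i \<in> S then 1 else 0) =
    (\<Sum>m\<in>{m \<in> Poly_Mapping.keys g. Poly_Mapping.keys m \<subseteq> S}. Poly_Mapping.lookup g m)"
proof -
  have "(\<Prod>i\<in>UNIV. ((\<chi> i. if i \<in> S then 1 else (0::'a)) $ i) ^ Poly_Mapping.lookup m i)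
      = (if Poly_Mapping.keys m \<subseteq> S then 1 else 0)" for m :: "4 \<Rightarrow>\<^sub>0 nat"
  proof (cases "Poly_Mapping.keys m \<subseteq> S")
    case True
    then have "((\<chi> i. if i \<in> S then 1 else (0::'a)) $ i) ^ Poly_Mapping.lookup m i = 1" for i
      by (metis (mono_tags, lifting) in_keys_iff power_0 power_one subsetD vec_lambda_beta)
    then show ?thesis using True by simp
  next
    case False
    then show ?thesis by (auto simp: in_keys_iff subset_iff)
  qed
  then have "eval4 g (\<chi> i. if i \<in> S then 1 else 0) = (\<Sum>m\<in>Poly_Mapping.keys g.
      if Poly_Mapping.keys m \<subseteq> S then Poly_Mapping.lookup g m else 0)"
    unfolding eval4_def by (intro sum.cong) (simp_all only: if_distrib[of "(*) _"] mult_1_right mult_zero_right)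
  then show ?thesis
    by (simp add: sum.If_cases Int_def)
qed

text \<open>Over a small field a polynomial is not determined by its values, but the coefficients of a
  quadratic form can still be read off at 0-1-vectors.\<close>

lemma indets_of_translation_invariant:
  assumes "is_form 2 g" and inv: "\<And>v. eval4 g (v + axis k 1) = eval4 g v"
  shows "k \<notin> indets g"
proof
  assume "k \<in> indets g"
  then obtain m where m: "m \<in> Poly_Mapping.keys g" "k \<in> Poly_Mapping.keys m"
    by (auto simp: indets_def)
  have deg: "(\<Sum>i\<in>UNIV. Poly_Mapping.lookup m i) = 2" if "m \<in> Poly_Mapping.keys g" for m
    using assms(1) that by (auto simp: is_form_def)
  \<comment> \<open>The indicator vectors of \<open>S\<close> and \<open>insert k S\<close> differ
    by \<open>axis k 1\<close>, so \<open>g\<close> agrees at them; the coefficients in which the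
    two partial sums differ therefore add up to 0.\<close>
  have sum_zero: "sum (Poly_Mapping.lookup g)
      {m \<in> Poly_Mapping.keys g. k \<in> Poly_Mapping.keys m \<and> Poly_Mapping.keys m \<subseteq> insert k S} = 0"
    (is "sum _ ?T = 0") if "k \<notin> S" for S
  proof -
    let ?U = "{m \<in> Poly_Mapping.keys g. Poly_Mapping.keys m \<subseteq> S}"
    have split: "{m \<in> Poly_Mapping.keys g. Poly_Mapping.keys m \<subseteq> insert k S} = ?U \<union> ?T"
      by auto
    have step: "(\<chi> i. if i \<in> insert k S then 1 else 0) = (\<chi> i. if i \<in> S then 1 else 0) + axis k (1::'a)"
      using that by (auto simp: vec_eq_iff axis_def)
    have "sum (Poly_Mapping.lookup g) (?U \<union> ?T) = eval4 g (\<chi> i. if i \<in> insert k S then 1 else 0)"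
      by (simp only: eval4_indicator split)
    also have "\<dots> = sum (Poly_Mapping.lookup g) ?U"
      by (simp only: step inv eval4_indicator)
    finally have "sum (Poly_Mapping.lookup g) (?U \<union> ?T) = sum (Poly_Mapping.lookup g) ?U" .
    moreover have "?U \<inter> ?T = {}"
      using that by auto
    ultimately show ?thesis
      by (simp add: sum.union_disjoint)
  qed
  \<comment> \<open>With \<open>S = {}\<close> the only possible monomial in the sum is the square
    of x_k, so its coefficient vanishes.\<close>
  have square: "Poly_Mapping.single k 1 + Poly_Mapping.single k 1 \<notin> Poly_Mapping.keys g" (is "?n \<notin> _")
  proof
    assume n: "?n \<in> Poly_Mapping.keys g"
    have "m = ?n" if n: "m \<in> Poly_Mapping.keys g" "k \<in> Poly_Mapping.keys m" "Poly_Mapping.keys m \<subseteq> {k}" for m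
    proof -
      obtain l where l: "m = Poly_Mapping.single k 1 + Poly_Mapping.single l 1"
        using monomial_degree_2[OF deg[OF n(1)] n(2)] .
      then have "l \<in> Poly_Mapping.keys m"
        unfolding l keys_single_add_single by simp
      with n(3) l show ?thesis
        by auto
    qed
    moreover have "Poly_Mapping.keys ?n \<subseteq> {k}" "k \<in> Poly_Mapping.keys ?n"
      unfolding keys_single_add_single by auto
    ultimately have "{m \<in> Poly_Mapping.keys g. k \<in> Poly_Mapping.keys m \<and> Poly_Mapping.keys m \<subseteq> {k}} = {?n}"
      using n by blast
    with sum_zero[of "{}"] have "Poly_Mapping.lookup g ?n = 0"
      by (simp only: sum.insert finite.emptyI empty_iff sum.empty not_False_eq_True add_0_right)
    with n show False
      by (simp only: in_keys_iff not_True_eq_False simp_thms)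
  qed
  \<comment> \<open>With the square excluded, taking \<open>S = {j}\<close> isolates the mixed
    monomial x_k x_j and kills its coefficient as well.\<close>
  obtain j where j: "m = Poly_Mapping.single k 1 + Poly_Mapping.single j 1"
    using monomial_degree_2[OF deg[OF m(1)] m(2)] .
  with m square have "j \<noteq> k"
    by auto
  have "m' = m" if n: "m' \<in> Poly_Mapping.keys g" "k \<in> Poly_Mapping.keys m'" "Poly_Mapping.keys m' \<subseteq> {k, j}" for m'
  proof -
    obtain l where l: "m' = Poly_Mapping.single k 1 + Poly_Mapping.single l 1"
      using monomial_degree_2[OF deg[OF n(1)] n(2)] .
    then have "l \<in> Poly_Mapping.keys m'"
      by (simp add: in_keys_iff lookup_add)
    with n(3) have "l = k \<or> l = j"
      by blast
    moreover have "l \<noteq> k"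
      using n(1) square l by blast
    ultimately show ?thesis
      using l j by blast
  qed
  moreover have "Poly_Mapping.keys m \<subseteq> {k, j}"
    unfolding j keys_single_add_single by simp
  ultimately have "{m \<in> Poly_Mapping.keys g. k \<in> Poly_Mapping.keys m \<and> Poly_Mapping.keys m \<subseteq> {k, j}} = {m}"
    using m by blast
  with sum_zero[of "{j}"] \<open>j \<noteq> k\<close> have "Poly_Mapping.lookup g m = 0"
    by simp
  with m(1) show False
    by (simp only: in_keys_iff simp_thms)
qed

subsection \<open>Quadratic functions\<close>

text \<open>No symmetry is imposed on the coefficients, so \<open>a\<close> is not unique; closure
  under sums is then immediate and characteristic 2 needs no separate treatment.\<close>

definition quadratic_function :: "('a::field ^ 4 \<Rightarrow> 'a) \<Rightarrow> bool"
  where "quadratic_function Q \<longleftrightarrow> (\<exists>a. Q = (\<lambda>v. \<Sum>i\<in>UNIV. \<Sum>j\<in>UNIV. a i j * (v $ i * v $ j)))"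

text \<open>The symmetric bilinear form associated with \<open>Q\<close>, without division by 2 so
  that it makes sense in every characteristic.\<close>

definition polar :: "('a::field ^ 4 \<Rightarrow> 'a) \<Rightarrow> 'a ^ 4 \<Rightarrow> 'a ^ 4 \<Rightarrow> 'a"
  where "polar Q u v = Q (u + v) - Q u - Q v"

lemma quadratic_function_monomial: "quadratic_function (\<lambda>v. c * (v $ i * v $ j))"
proof -
  have "c * (v $ i * v $ j) = (\<Sum>k\<in>UNIV. \<Sum>l\<in>UNIV. (if k = i then if l = j then c else 0 else 0) * (v $ k * v $ l))" for v
  proof -
    have "(\<Sum>l\<in>UNIV. (if k = i then if l = j then c else 0 else 0) * (v $ k * v $ l))
        = (if k = i then c * (v $ k * v $ j) else 0)" for k
      by (simp add: if_distrib[of "\<lambda>x. x * _"] cong: if_cong)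
    then show ?thesis by simp
  qed
  then show ?thesis
    unfolding quadratic_function_def by (intro exI ext)
qed

lemma quadratic_function_zero: "quadratic_function (\<lambda>v. 0)"
  using quadratic_function_monomial[of 0] by simp

lemma quadratic_function_add:
  assumes "quadratic_function P" "quadratic_function Q"
  shows "quadratic_function (\<lambda>v. P v + Q v)"
proof -
  obtain a b where "P = (\<lambda>v. \<Sum>i\<in>UNIV. \<Sum>j\<in>UNIV. a i j * (v $ i * v $ j))"
    "Q = (\<lambda>v. \<Sum>i\<in>UNIV. \<Sum>j\<in>UNIV. b i j * (v $ i * v $ j))"
    using assms by (auto simp: quadratic_function_def)
  then have "(\<lambda>v. P v + Q v) = (\<lambda>v. \<Sum>i\<in>UNIV. \<Sum>j\<in>UNIV. (a i j + b i j) * (v $ i * v $ j))"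
    by (simp add: sum.distrib distrib_right)
  then show ?thesis
    unfolding quadratic_function_def by (rule exI[where x = "\<lambda>i j. a i j + b i j"])
qed

lemma quadratic_function_sum:
  "(\<And>m. m \<in> S \<Longrightarrow> quadratic_function (f m)) \<Longrightarrow> quadratic_function (\<lambda>v. \<Sum>m\<in>S. f m v)"
  by (induction S rule: infinite_finite_induct) (auto simp: quadratic_function_zero quadratic_function_add)

lemma quadratic_function_eval4:
  assumes "is_form 2 f"
  shows "quadratic_function (eval4 f)"
  unfolding eval4_def
proof (rule quadratic_function_sum)
  fix m assume "m \<in> Poly_Mapping.keys f"
  then have deg: "(\<Sum>i\<in>UNIV. Poly_Mapping.lookup m i) = 2"
    using assms by (auto simp: is_form_def)
  then obtain i where "i \<in> Poly_Mapping.keys m"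
    by (metis in_keys_iff sum.neutral zero_neq_numeral)
  then obtain j where j: "m = Poly_Mapping.single i 1 + Poly_Mapping.single j 1"
    using monomial_degree_2 deg by blast
  have "(\<Prod>k\<in>UNIV. (v $ k) ^ Poly_Mapping.lookup m k) = v $ i * v $ j" for v :: "'a ^ 4"
    using eval4_mult[of "var4 i" "var4 j" v]
    by (simp add: eval4_var4) (simp add: var4_def mult_single eval4_single j)
  then show "quadratic_function (\<lambda>v. Poly_Mapping.lookup f m * (\<Prod>k\<in>UNIV. (v $ k) ^ Poly_Mapping.lookup m k))"
    by (simp add: quadratic_function_monomial)
qed

text \<open>The way back from functions to formal polynomials, used to show that every form of
  bidegree (2,2) comes from a codeword.\<close>

lemma quadratic_function_is_form:
  assumes "quadratic_function Q"
  obtains f where "is_form 2 f" "eval4 f = Q"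
proof -
  obtain a where Q: "Q = (\<lambda>v. \<Sum>i\<in>UNIV. \<Sum>j\<in>UNIV. a i j * (v $ i * v $ j))"
    using assms by (auto simp: quadratic_function_def)
  let ?f = "\<Sum>i\<in>UNIV. \<Sum>j\<in>UNIV. const4 (a i j) * (var4 i * var4 j)"
  have "is_form (0 + (1 + 1)) ?f"
    by (intro is_form_sum is_form_mult is_form_const4 is_form_var4)
  moreover have "eval4 ?f = Q"
    by (rule ext) (simp add: Q eval4_sum eval4_mult eval4_const4 eval4_var4)
  ultimately show ?thesis using that by (simp add: numeral_2_eq_2)
qed

section \<open>Bilinearity of the polar form and hyperbolic pairs\<close>

context
  fixes Q :: "'a::field ^ 4 \<Rightarrow> 'a"
  assumes Q: "quadratic_function Q"
begin

lemma quadratic_function_scale: "Q (c *s v) = c\<^sup>2 * Q v"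
  using Q by (auto simp: quadratic_function_def sum_distrib_left power2_eq_square mult_ac)

text \<open>Expanding \<open>Q (u + v)\<close> and cancelling \<open>Q u\<close> and
  \<open>Q v\<close> leaves the cross terms; renaming the indices in half of them gives the
  symmetrised coefficients.\<close>

lemma polar_bilinear:
  obtains b where "\<And>u v. polar Q u v = (\<Sum>i\<in>UNIV. \<Sum>j\<in>UNIV. b i j * (u $ i * v $ j))"
proof -
  obtain a where a: "Q = (\<lambda>v. \<Sum>i\<in>UNIV. \<Sum>j\<in>UNIV. a i j * (v $ i * v $ j))"
    using Q by (auto simp: quadratic_function_def)
  have "(\<Sum>i\<in>UNIV. \<Sum>j\<in>UNIV. a i j * (v $ i * u $ j)) = (\<Sum>i\<in>UNIV. \<Sum>j\<in>UNIV. a j i * (u $ i * v $ j))" for u v :: "'a ^ 4"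
    by (subst sum.swap) (simp add: mult_ac)
  then have "polar Q u v = (\<Sum>i\<in>UNIV. \<Sum>j\<in>UNIV. (a i j + a j i) * (u $ i * v $ j))" for u v
    by (simp add: polar_def a sum.distrib distrib_left distrib_right)
  then show ?thesis
    by (rule that[of "\<lambda>i j. a i j + a j i"])
qed

lemma polar_add: "polar Q (u + u') v = polar Q u v + polar Q u' v"
  by (rule polar_bilinear) (simp add: sum.distrib distrib_left distrib_right)

lemma polar_scale: "polar Q (c *s u) v = c * polar Q u v"
  by (rule polar_bilinear) (simp add: sum_distrib_left mult_ac)

lemma polar_commute: "polar Q u v = polar Q v u"
  by (simp add: polar_def add.commute)

lemma polar_add_right: "polar Q v (u + u') = polar Q v u + polar Q v u'"
  by (simp add: polar_commute[of v] polar_add)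

lemma polar_scale_right: "polar Q v (c *s u) = c * polar Q v u"
  by (simp add: polar_commute[of v] polar_scale)

lemma quadratic_function_plus: "Q (u + v) = Q u + Q v + polar Q u v"
  by (simp add: polar_def)

text \<open>\<open>Q (u + u) = Q (2 *s u) = 4 * Q u\<close>, an argument independent of the
  characteristic.\<close>

lemma polar_self: "Q u = 0 \<Longrightarrow> polar Q u u = 0"
proof -
  assume "Q u = 0"
  moreover have "u + u = 2 *s u"
    by (simp add: vec_eq_iff)
  ultimately show ?thesis
    using quadratic_function_scale[of 2 u] by (simp only: polar_def) simp
qed

lemmas polar_simps = polar_add polar_add_right polar_scale polar_scale_right

text \<open>Scaling \<open>w\<close> adjusts its product with \<open>u\<close> to \<open>c\<close>.
  Adding a multiple of the singular vector \<open>u\<close> keeps this product and shifts the value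
  of \<open>Q\<close> by a multiple of \<open>c\<close>, so that value can be made 0.\<close>

lemma hyperbolic_partner:
  assumes "Q u = 0" "polar Q u w \<noteq> 0" "c \<noteq> 0"
  obtains w' a b where "w' = a *s u + b *s w" "Q w' = 0" "polar Q u w' = c"
proof -
  define b where "b = c / polar Q u w"
  define a where "a = - (b * Q w / polar Q u w)"
  have "polar Q u (a *s u + b *s w) = b * polar Q u w"
    using assms by (simp only: polar_simps polar_self) simp
  moreover have "Q (a *s u + b *s w) = b\<^sup>2 * Q w + a * (b * polar Q u w)"
    using assms by (simp only: quadratic_function_plus polar_simps quadratic_function_scale) simp
  ultimately show ?thesis
    using that[of "a *s u + b *s w" a b] assms by (simp add: a_def b_def power2_eq_square)
qed

end

section \<open>Rank four and singular vectors\<close>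

lemma form_rank_le_indets:
  "invertible A \<Longrightarrow> form_rank f \<le> card (indets (lin_subst A f))"
  unfolding form_rank_def by (rule Least_le) blast

text \<open>If a singular \<open>u\<close> were orthogonal to everything, the form would be
  invariant under translation by \<open>u\<close>. In coordinates with \<open>u\<close> as a basis
  vector one indeterminate would then be absent, giving rank at most 3.\<close>

lemma full_rank_no_singular_radical:
  fixes f :: "'a::field poly4"
  assumes f: "is_form 2 f" and rank: "form_rank f = 4"
    and u: "u \<noteq> 0" "eval4 f u = 0"
  obtains w where "polar (eval4 f) u w \<noteq> 0"
proof (rule ccontr)
  assume "\<not> thesis"
  then have rad: "polar (eval4 f) u w = 0" for w
    using that by blast
  obtain k where k: "u $ k \<noteq> 0"
    using u(1) by (auto simp: vec_eq_iff)
  \<comment> \<open>The identity matrix with column \<open>k\<close> replaced by \<open>u\<close>;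
    it maps \<open>axis k 1\<close> to \<open>u\<close> and is invertible because
    \<open>u $ k\<close> is nonzero.\<close>
  define A :: "'a ^ 4 ^ 4" where "A = (\<chi> i j. if j = k then u $ i else if i = j then 1 else 0)"
  have A: "A *v v = (\<chi> i. u $ i * v $ k + (if i = k then 0 else v $ i))" for v
  proof -
    have "(\<Sum>j\<in>UNIV. (if j = k then u $ i else if i = j then 1 else 0) * v $ j)
        = (\<Sum>j\<in>UNIV. (if j = k then u $ i * v $ j else 0) + (if j = i then (if i = k then 0 else v $ j) else 0))" for i
      by (rule sum.cong) auto
    then show ?thesis
      by (simp add: A_def matrix_vector_mult_def sum.distrib)
  qed
  have "v = 0" if "A *v v = 0" for v
  proof -
    have eq: "u $ i * v $ k + (if i = k then 0 else v $ i) = 0" for i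
      using that by (simp add: A vec_eq_iff)
    have "v $ k = 0"
      using k eq[of k] by simp
    then have "v $ i = 0" for i
      using eq[of i] by (cases "i = k") simp_all
    then show ?thesis
      unfolding vec_eq_iff zero_index by blast
  qed
  then have "invertible A"
    unfolding invertible_left_inverse matrix_left_invertible_ker by blast
  moreover have "card (indets (lin_subst A f)) < 4"
  proof -
    have "eval4 (lin_subst A f) (v + axis k 1) = eval4 (lin_subst A f) v" for v
    proof -
      have "A *v (v + axis k 1) = u + A *v v"
        unfolding vec_eq_iff A by (simp add: axis_def distrib_left)
      then show ?thesis
        using rad[of "A *v v"] u(2) by (simp add: eval4_lin_subst polar_def)
    qed
    then have "k \<notin> indets (lin_subst A f)"
      using indets_of_translation_invariant is_form_lin_subst[OF f] by blast
    then have "indets (lin_subst A f) \<subset> UNIV"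
      by auto
    then have "card (indets (lin_subst A f)) < card (UNIV :: 4 set)"
      by (intro psubset_card_mono) auto
    then show ?thesis by simp
  qed
  ultimately show False
    using form_rank_le_indets[of A f] rank by simp
qed

subsection \<open>Points of the quadric\<close>

lemma span_singleton_scale:
  fixes v :: "'a::field ^ 'n"
  assumes "c \<noteq> 0"
  shows "vec.span {c *s v} = vec.span {v}"
proof -
  have "k *s v \<in> range (\<lambda>k. k *s (c *s v))" for k
    using assms by (intro image_eqI[of _ _ "k / c"]) auto
  then show ?thesis
    by (auto simp: vec.span_singleton)
qed

text \<open>By homogeneity, vanishing at one representative gives vanishing at all
  multiples.\<close>

lemma zero_set_span_iff:
  assumes "is_form 2 f" "v \<noteq> 0"
  shows "vec.span {v} \<in> zero_set f \<longleftrightarrow> eval4 f v = 0"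
proof -
  have "v \<in> vec.span {v}"
    by (simp add: vec.span_base)
  moreover have "eval4 f (c *s v) = c\<^sup>2 * eval4 f v" for c
    by (rule quadratic_function_scale[OF quadratic_function_eval4[OF assms(1)]])
  ultimately show ?thesis
    using assms(2) by (fastforce simp: zero_set_def proj_space3_def vec.span_singleton)
qed

lemma zero_set_elim:
  assumes "is_form 2 f" "p \<in> zero_set f"
  obtains v where "v \<noteq> 0" "p = vec.span {v}" "eval4 f v = 0"
  using assms zero_set_span_iff by (auto simp: zero_set_def proj_space3_def)

lemma ovoid_or_singular_vector:
  fixes f :: "'a::{field,finite} poly4"
  assumes f: "is_form 2 f"
    and u: "eval4 f u = 0" and w: "eval4 f w = 0" "polar (eval4 f) u w = 1"
    and card: "card (zero_set f) > CARD('a)\<^sup>2 + 1"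
  obtains z where "z \<noteq> 0" "eval4 f z = 0" "polar (eval4 f) u z = 0" "polar (eval4 f) w z = 0"
proof (rule ccontr)
  assume "\<not> thesis"
  note witness = that
  define Q where "Q = eval4 f"
  define W where "W = {z. polar Q u z = 0 \<and> polar Q w z = 0}"
  have anisotropic: "z = 0" if "z \<in> W" "Q z = 0" for z
    using \<open>\<not> thesis\<close> that witness[of z] by (auto simp: W_def Q_def)
  have Q: "quadratic_function Q"
    unfolding Q_def using f by (rule quadratic_function_eval4)
  note simps = quadratic_function_plus[OF Q] quadratic_function_scale[OF Q] polar_simps[OF Q] polar_self[OF Q]
  have uw: "Q u = 0" "Q w = 0" "polar Q u w = 1" "polar Q w u = 1"
    using u w polar_commute[OF Q] by (auto simp: Q_def)
  have Wu: "polar Q u z = 0" "polar Q w z = 0" "polar Q z u = 0" "polar Q z w = 0" if "z \<in> W" for z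
    using that polar_commute[OF Q] by (auto simp: W_def)
  have Q_split: "Q (s *s u + t *s w + z) = s * t + Q z" if "z \<in> W" for s t z
    by (simp add: simps uw Wu[OF that])
  \<comment> \<open>The coefficients \<open>s\<close> and \<open>t\<close> are recovered by pairing
    with \<open>w\<close> and \<open>u\<close>, so the decomposition is unique; counting vectors
    then bounds the size of \<open>W\<close> by q^2.\<close>
  have "inj_on (\<lambda>(s, t, z). s *s u + t *s w + z) (UNIV \<times> UNIV \<times> W)"
  proof (rule inj_onI)
    fix x x' :: "'a \<times> 'a \<times> ('a ^ 4)"
    assume W: "x \<in> UNIV \<times> UNIV \<times> W" "x' \<in> UNIV \<times> UNIV \<times> W"
      and eq: "(case x of (s, t, z) \<Rightarrow> s *s u + t *s w + z) = (case x' of (s, t, z) \<Rightarrow> s *s u + t *s w + z)"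
    obtain s t z s' t' z' where x: "x = (s, t, z)" "x' = (s', t', z')"
      by (cases x, cases x') auto
    have W: "z \<in> W" "z' \<in> W" and eq: "s *s u + t *s w + z = s' *s u + t' *s w + z'"
      using W eq by (auto simp: x)
    have "polar Q w (s *s u + t *s w + z) = s" "polar Q u (s *s u + t *s w + z) = t"
      "polar Q w (s' *s u + t' *s w + z') = s'" "polar Q u (s' *s u + t' *s w + z') = t'"
      using W by (simp_all add: simps uw Wu)
    with eq show "x = x'"
      by (auto simp: x)
  qed
  then have "card (UNIV \<times> UNIV \<times> W :: ('a \<times> 'a \<times> _) set) \<le> CARD('a ^ 4)"
    by (rule card_inj_on_le) auto
  then have "CARD('a)\<^sup>2 * card W \<le> CARD('a)\<^sup>2 * CARD('a)\<^sup>2"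
    by (simp add: card_cartesian_product power2_eq_square power4_eq_xxxx mult.assoc)
  then have W_card: "card W \<le> CARD('a)\<^sup>2"
    unfolding mult_le_cancel1 by simp
  \<comment> \<open>Points with no \<open>u\<close>-component reduce to the span of
    \<open>w\<close>, which is the extra 1 in the bound; every other point is determined by an
    element of \<open>W\<close>.\<close>
  have "zero_set f \<subseteq> insert (vec.span {w}) ((\<lambda>z. vec.span {u + (- Q z) *s w + z}) ` W)"
  proof
    fix p assume "p \<in> zero_set f"
    then obtain v where v: "v \<noteq> 0" "p = vec.span {v}" "Q v = 0"
      using zero_set_elim[OF f] by (metis Q_def)
    define s where "s = polar Q w v"
    define t where "t = polar Q u v"
    \<comment> \<open>Removing the components along \<open>u\<close> and \<open>w\<close> projects
      \<open>v\<close> to \<open>W\<close>; as \<open>u\<close> and \<open>w\<close> have product 1,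
      the coefficient of each is the product of \<open>v\<close> with the other.\<close>
    define z where "z = v + (- s) *s u + (- t) *s w"
    have z: "z \<in> W"
      by (simp only: W_def z_def mem_Collect_eq simps uw) (simp add: s_def t_def simps uw)
    have v_eq: "v = s *s u + t *s w + z"
      by (simp add: z_def vec_eq_iff)
    have Qz: "s * t + Q z = 0"
      using Q_split[OF z, of s t] v v_eq by simp
    show "p \<in> insert (vec.span {w}) ((\<lambda>z. vec.span {u + (- Q z) *s w + z}) ` W)"
    proof (cases "s = 0")
      case True
      with Qz z have "z = 0"
        using anisotropic by simp
      with True v v_eq have "v = t *s w" "t \<noteq> 0" by auto
      with v show ?thesis
        by (simp add: span_singleton_scale)
    next
      case False
      \<comment> \<open>Dividing by \<open>s\<close> normalises the coefficient of \<open>u\<close>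
        to 1; the vanishing of \<open>Q\<close> then forces the coefficient of \<open>w\<close> to
        be \<open>- Q y\<close>.\<close>
      define y where "y = (1 / s) *s z"
      have "y \<in> W"
        using z by (simp add: y_def W_def simps)
      moreover have Qy: "s * (- Q y) = t" "s *s y = z"
        using Qz False by (simp_all add: y_def simps field_simps power2_eq_square add_eq_0_iff)
      have "v = s *s (u + (- Q y) *s w + y)"
        by (simp only: vec.scale_right_distrib vec.scale_scale Qy v_eq)
      with v False have "p = vec.span {u + (- Q y) *s w + y}"
        by (metis span_singleton_scale)
      ultimately show ?thesis by blast
    qed
  qed
  then have "card (zero_set f) \<le> card (insert (vec.span {w}) ((\<lambda>z. vec.span {u + (- Q z) *s w + z}) ` W))"
    by (rule card_mono[rotated]) simp
  also have "\<dots> \<le> card W + 1"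
    by (simp add: card_insert_if card_image_le le_SucI)
  finally show False
    using card W_card by simp
qed

section \<open>The normal form y1 y4 - y2 y3\<close>

definition column_matrix :: "'a ^ 4 \<Rightarrow> 'a ^ 4 \<Rightarrow> 'a ^ 4 \<Rightarrow> 'a ^ 4 \<Rightarrow> ('a::field) ^ 4 ^ 4"
  where "column_matrix a b c d = (\<chi> i j. if j = 1 then a $ i else if j = 2 then b $ i else if j = 3 then c $ i else d $ i)"

text \<open>In the index type \<open>4\<close> equals \<open>0\<close>, so the final branch of the
  definition is the column numbered 4.\<close>

lemma column_matrix_mult:
  "column_matrix a b c d *v y = y $ 1 *s a + y $ 2 *s b + y $ 3 *s c + y $ 4 *s d"
  by (simp add: column_matrix_def matrix_vector_mult_def sum_4 vec_eq_iff algebra_simps)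

text \<open>A kernel vector of \<open>N\<close> is orthogonal to everything for the polar form of y1
  y4 - y2 y3. Testing against the four unit vectors shows that all its coordinates vanish.\<close>

lemma invertible_of_hyperbolic:
  fixes N :: "'a::field ^ 4 ^ 4"
  assumes Q: "quadratic_function Q"
    and N: "\<And>y. Q (N *v y) = y $ 1 * y $ 4 - y $ 2 * y $ 3"
  shows "invertible N"
proof -
  have "y = 0" if "N *v y = 0" for y
  proof -
    have "Q 0 = 0"
      using quadratic_function_scale[OF Q, of 0 0] by simp
    then have "polar Q (N *v y) (N *v x) = 0" for x :: "'a ^ 4"
      using that by (simp add: polar_def)
    then have "y $ 1 * x $ 4 + y $ 4 * x $ 1 - y $ 2 * x $ 3 - y $ 3 * x $ 2 = 0" for x :: "'a ^ 4"
      by (simp add: polar_def N algebra_simps flip: matrix_vector_right_distrib)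
    from this[of "axis 1 1"] this[of "axis 2 1"] this[of "axis 3 1"] this[of "axis 4 1"]
    show "y = 0"
      by (simp add: axis_def vec_eq_iff forall_4)
  qed
  then show ?thesis
    unfolding invertible_left_inverse matrix_left_invertible_ker by blast
qed

lemma hyperbolic_normal_form:
  fixes f :: "'a::{field,finite} poly4"
  assumes f: "is_form 2 f" and rank: "form_rank f = 4"
    and card: "card (zero_set f) = (CARD('a) + 1)\<^sup>2"
  obtains N :: "'a ^ 4 ^ 4" where "invertible N" "\<And>y. eval4 f (N *v y) = y $ 1 * y $ 4 - y $ 2 * y $ 3"
proof -
  define Q where "Q = eval4 f"
  have Q: "quadratic_function Q"
    unfolding Q_def using f by (rule quadratic_function_eval4)
  note simps = quadratic_function_plus[OF Q] quadratic_function_scale[OF Q] polar_simps[OF Q] polar_self[OF Q]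
  have "zero_set f \<noteq> {}"
    using card by auto
  then obtain u where u: "u \<noteq> 0" "Q u = 0"
    using zero_set_elim[OF f] by (metis Q_def ex_in_conv)
  obtain v where "polar Q u v \<noteq> 0"
    using full_rank_no_singular_radical[OF f rank u[unfolded Q_def]] unfolding Q_def by blast
  then obtain w where w: "Q w = 0" "polar Q u w = 1"
    using hyperbolic_partner[OF Q u(2), of v 1] by auto
  \<comment> \<open>(q + 1)^2 exceeds q^2 + 1 by 2q.\<close>
  have big: "card (zero_set f) > CARD('a)\<^sup>2 + 1"
    using card by (simp add: power2_eq_square)
  obtain e where e: "e \<noteq> 0" "Q e = 0" "polar Q u e = 0" "polar Q w e = 0"
    using ovoid_or_singular_vector[OF f u(2)[unfolded Q_def] w[unfolded Q_def] big] unfolding Q_def by blast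
  obtain x where x: "polar Q e x \<noteq> 0"
    using full_rank_no_singular_radical[OF f rank e(1,2)[unfolded Q_def]] unfolding Q_def by blast
  \<comment> \<open>The component of \<open>x\<close> in the plane of \<open>u\<close> and
    \<open>w\<close> is removed; \<open>e\<close> is orthogonal to that plane, so the product with
    \<open>e\<close> stays nonzero.\<close>
  define z where "z = x + (- polar Q w x) *s u + (- polar Q u x) *s w"
  note comm = polar_commute[OF Q]
  have pairs: "polar Q w u = 1" "polar Q e u = 0" "polar Q e w = 0"
    using e w comm by metis+
  have z: "polar Q e z \<noteq> 0" "polar Q u z = 0" "polar Q w z = 0"
    using x u w e pairs by (simp_all only: z_def simps) simp_all
  \<comment> \<open>The product -1 produces the minus sign of y2 y3. Being a combination of
    \<open>e\<close> and \<open>z\<close>, the vector \<open>e'\<close> stays orthogonal to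
    \<open>u\<close> and \<open>w\<close>, so the two hyperbolic planes are orthogonal.\<close>
  obtain e' a b where e': "e' = a *s e + b *s z" "Q e' = 0" "polar Q e e' = - 1"
    using hyperbolic_partner[OF Q e(2) z(1), of "-1"] by auto
  have e'_pairs: "polar Q u e' = 0" "polar Q w e' = 0"
    using e z by (simp_all add: e'(1) simps)
  have "Q (y1 *s u + y2 *s e + y3 *s e' + y4 *s w) = y1 * y4 - y2 * y3" for y1 y2 y3 y4
    using u w e e'(2,3) e'_pairs pairs comm[of e' w] by (simp add: simps)
  then have "Q (column_matrix u e e' w *v y) = y $ 1 * y $ 4 - y $ 2 * y $ 3" for y
    by (simp only: column_matrix_mult)
  with invertible_of_hyperbolic[OF Q, of "column_matrix u e e' w"] that show ?thesis
    unfolding Q_def by blast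
qed

subsection \<open>Biquadratic forms on the product of two projective lines\<close>

text \<open>The projective line is \<open>'a option\<close>: \<open>Some x\<close> is the point $(1 : x)$ and \<open>None\<close> is $(0 : 1)$.
  At these representatives \<open>line_monom d i\<close> is the monomial $s_0^{d-i} s_1^i$.\<close>

definition line_monom :: "nat \<Rightarrow> nat \<Rightarrow> 'a::field option \<Rightarrow> 'a"
  where "line_monom d i s = (case s of None \<Rightarrow> if i = d then 1 else 0 | Some x \<Rightarrow> x ^ i)"

text \<open>At \<open>None\<close> a monomial is nonzero only in top degree; the bounds ensure that
  \<open>i + j = d + e\<close> forces both exponents to be maximal.\<close>

lemma line_monom_mult:
  "i \<le> d \<Longrightarrow> j \<le> e \<Longrightarrow> line_monom d i s * line_monom e j s = line_monom (d + e) (i + j) s"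
  by (auto simp: line_monom_def power_add split: option.split)

section \<open>Zeros and weights of forms of bidegree (2,2)\<close>

definition biform :: "(nat \<times> nat \<Rightarrow> 'a::field) \<Rightarrow> 'a option \<times> 'a option \<Rightarrow> 'a"
  where "biform c x = (\<Sum>k\<in>{..2} \<times> {..2}. c k * (line_monom 2 (fst k) (fst x) * line_monom 2 (snd k) (snd x)))"

text \<open>The finite zeros are roots of a nonzero polynomial of degree at most 2. The point
  \<open>None\<close> is a further zero exactly when \<open>a 2 = 0\<close>, and then the degree
  drops to at most 1.\<close>

lemma binary_quadratic_zeros:
  fixes a :: "nat \<Rightarrow> 'a::{field,finite}"
  assumes "l \<le> 2" "a l \<noteq> 0"
  shows "card {t. (\<Sum>i\<le>2. a i * line_monom 2 i t) = 0} \<le> 2"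
proof -
  define p where "p = [:a 0, a 1, a 2:]"
  have "p \<noteq> 0"
    using assms by (auto simp: p_def le_Suc_eq numeral_2_eq_2)
  have val: "(\<Sum>i\<le>2. a i * line_monom 2 i t) = (case t of None \<Rightarrow> a 2 | Some x \<Rightarrow> poly p x)" for t
    by (auto simp: p_def line_monom_def eval_nat_numeral algebra_simps split: option.split)
  define R where "R = {x. poly p x = 0}"
  have R: "finite R" "card R \<le> degree p"
    using \<open>p \<noteq> 0\<close> card_poly_roots_bound[of p] poly_roots_finite[of p] by (auto simp: R_def)
  show ?thesis
  proof (cases "a 2 = 0")
    case True
    then have "degree p \<le> 1"
      by (simp add: p_def)
    have "t \<in> insert None (Some ` R)" if "(\<Sum>i\<le>2. a i * line_monom 2 i t) = 0" for t
      using that by (cases t) (auto simp: val R_def)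
    then have "card {t. (\<Sum>i\<le>2. a i * line_monom 2 i t) = 0} \<le> card (insert None (Some ` R))"
      by (intro card_mono) auto
    also have "\<dots> \<le> 2"
      using R \<open>degree p \<le> 1\<close> by (simp add: card_insert_if card_image)
    finally show ?thesis .
  next
    case False
    have "t \<in> Some ` R" if "(\<Sum>i\<le>2. a i * line_monom 2 i t) = 0" for t
      using that False by (cases t) (auto simp: val R_def)
    then have "card {t. (\<Sum>i\<le>2. a i * line_monom 2 i t) = 0} \<le> card (Some ` R)"
      by (intro card_mono) auto
    also have "\<dots> \<le> degree p"
      using R by (simp add: card_image)
    also have "\<dots> \<le> 2"
      by (simp add: p_def)
    finally show ?thesis .
  qed
qed

lemma biform_zeros:
  fixes c :: "nat \<times> nat \<Rightarrow> 'a::{field,finite}"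
  assumes "k \<in> {..2} \<times> {..2}" "c k \<noteq> 0"
  shows "card {x. biform c x = 0} \<le> 4 * CARD('a)"
proof -
  \<comment> \<open>The coefficients of the restriction to the line over \<open>s\<close>; each is
    itself a binary quadratic form in \<open>s\<close>.\<close>
  define col where "col s l = (\<Sum>i\<le>2. c (i, l) * line_monom 2 i s)" for s l
  have fibre: "biform c (s, t) = (\<Sum>l\<le>2. col s l * line_monom 2 l t)" for s t
    unfolding biform_def col_def sum_distrib_right
    by (subst sum.swap) (simp add: sum.cartesian_product case_prod_beta mult.assoc)
  define K where "K = {s. \<forall>l\<le>2. col s l = 0}"
  \<comment> \<open>On lines contained in the zero set every coefficient vanishes, in particular the
    one numbered \<open>snd k\<close>, a nonzero binary form because of \<open>c k\<close>.\<close>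
  have "K \<subseteq> {s. (\<Sum>i\<le>2. c (i, snd k) * line_monom 2 i s) = 0}"
    using assms(1) by (auto simp: K_def col_def)
  then have "card K \<le> card {s. (\<Sum>i\<le>2. c (i, snd k) * line_monom 2 i s) = 0}"
    by (intro card_mono) auto
  also have "\<dots> \<le> 2"
    using assms by (intro binary_quadratic_zeros[of "fst k"]) auto
  finally have K: "card K \<le> 2" .
  \<comment> \<open>With r = q - 1, a full line has 2 + r points, so it adds r to the bound 2 valid
    for other lines.\<close>
  obtain r where r: "CARD('a) = Suc r"
    using zero_less_card_finite[where 'a = 'a] gr0_implies_Suc by blast
  have fibre_card: "card {t. biform c (s, t) = 0} \<le> 2 + (if s \<in> K then r else 0)" for s
  proof (cases "s \<in> K")
    case True
    have "card {t. biform c (s, t) = 0} \<le> CARD('a option)"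
      by (intro card_mono) auto
    with True r show ?thesis by simp
  next
    case False
    then obtain l where "l \<le> 2" "col s l \<noteq> 0"
      by (auto simp: K_def)
    with False show ?thesis
      using binary_quadratic_zeros[of l "col s"] by (simp add: fibre)
  qed
  have "{x. biform c x = 0} = (SIGMA s:UNIV. {t. biform c (s, t) = 0})"
    by auto
  then have "card {x. biform c x = 0} = (\<Sum>s\<in>UNIV. card {t. biform c (s, t) = 0})"
    by (simp add: card_SigmaI)
  also have "\<dots> \<le> (\<Sum>s\<in>(UNIV :: 'a option set). 2 + (if s \<in> K then r else 0))"
    by (intro sum_mono fibre_card)
  also have "\<dots> = 2 * CARD('a option) + card K * r"
    unfolding sum.distrib by (simp add: sum.If_cases)
  also have "\<dots> \<le> 2 * CARD('a option) + 2 * r"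
    using K by simp
  finally show ?thesis
    using r by simp
qed

text \<open>Of the (q + 1)^2 points at most 4q are zeros, and (q + 1)^2 - 4q = (q - 1)^2.\<close>

lemma biform_weight:
  fixes c :: "nat \<times> nat \<Rightarrow> 'a::{field,finite}"
  assumes "k \<in> {..2} \<times> {..2}" "c k \<noteq> 0"
  shows "card {x. biform c x \<noteq> 0} \<ge> (CARD('a) - 1)\<^sup>2"
proof -
  obtain r where r: "CARD('a) = Suc r"
    using zero_less_card_finite[where 'a = 'a] gr0_implies_Suc by blast
  have "{x. biform c x \<noteq> 0} = UNIV - {x. biform c x = 0}"
    by auto
  then have "card {x. biform c x \<noteq> 0} = (r + 2) * (r + 2) - card {x. biform c x = 0}"
    using r by (simp add: card_Diff_subset)
  moreover have "card {x. biform c x = 0} \<le> 4 * (r + 1)"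
    using biform_zeros[of k c, OF assms] r by simp
  moreover have "(r + 2) * (r + 2) = r * r + 4 * (r + 1)"
    by (simp add: algebra_simps)
  moreover have "(CARD('a) - 1)\<^sup>2 = r * r"
    using r by (simp add: power2_eq_square)
  ultimately show ?thesis
    by linarith
qed

text \<open>The form s0 s1 t0 t1 is nonzero exactly where both factors avoid the two points 0 and
  infinity.\<close>

lemma biform_weight_attained:
  "card {x :: 'a::{field,finite} option \<times> 'a option. biform (\<lambda>k. if k = (1, 1) then 1 else 0) x \<noteq> 0} = (CARD('a) - 1)\<^sup>2"
proof -
  have "biform (\<lambda>k. if k = (1, 1) then 1 else 0) x = line_monom 2 1 (fst x) * line_monom 2 1 (snd x)" for x :: "'a option \<times> 'a option"
    by (simp add: biform_def if_distrib[of "\<lambda>a. a * _"] cong: if_cong)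
  then have "{x :: 'a option \<times> 'a option. biform (\<lambda>k. if k = (1, 1) then 1 else 0) x \<noteq> 0}
      = Some ` (UNIV - {0}) \<times> Some ` (UNIV - {0})"
    by (auto simp: line_monom_def image_iff split: option.splits)
  then show ?thesis
    by (simp add: card_cartesian_product card_image card_Diff_singleton power2_eq_square)
qed

section \<open>Parameters of the code of forms of bidegree (2,2)\<close>

text \<open>The nowhere zero factor \<open>\<nu>\<close> accounts for the choice of representatives of the points.\<close>

lemma biform_code:
  fixes \<theta> :: "'p \<Rightarrow> 'a::{field,finite} option \<times> 'a option"
  assumes card: "CARD('a) \<ge> 3" and X: "finite X" and \<theta>: "bij_betw \<theta> X UNIV"
    and \<nu>: "\<And>p. p \<in> X \<Longrightarrow> \<nu> p \<noteq> 0"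
  shows "is_code X (range (\<lambda>c p. if p \<in> X then \<nu> p * biform c (\<theta> p) else 0))
    ((CARD('a) + 1)\<^sup>2) 9 ((CARD('a) - 1)\<^sup>2)"
proof -
  define I :: "(nat \<times> nat) set" where "I = {..2} \<times> {..2}"
  define \<Phi> where "\<Phi> c p = (if p \<in> X then \<nu> p * biform c (\<theta> p) else 0)" for c p
  \<comment> \<open>The words of the nine monomials; they turn out to be a basis.\<close>
  define b where "b k = \<Phi> (\<lambda>k'. if k' = k then 1 else 0)" for k
  have I: "finite I" "card I = 9"
    by (auto simp: I_def)
  have diff: "\<Phi> c p - \<Phi> d p = \<Phi> (\<lambda>k. c k - d k) p" for c d p
    by (simp add: \<Phi>_def biform_def sum_subtractf algebra_simps)
  have b: "b k = (\<lambda>p. if p \<in> X then \<nu> p * (line_monom 2 (fst k) (fst (\<theta> p)) * line_monom 2 (snd k) (snd (\<theta> p))) else 0)"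
    if "k \<in> I" for k
    using that by (auto simp: b_def \<Phi>_def biform_def I_def fun_eq_iff if_distrib[of "\<lambda>a. a * _"] cong: if_cong)
  have sum_apply: "(\<Sum>k\<in>S. g k) p = (\<Sum>k\<in>S. g k p)" for g :: "nat \<times> nat \<Rightarrow> 'p \<Rightarrow> 'a" and S p
    by (induction S rule: infinite_finite_induct) auto
  have expand: "\<Phi> c = (\<Sum>k\<in>I. word_scale (c k) (b k))" for c
  proof
    fix p
    have "(\<Sum>k\<in>I. word_scale (c k) (b k)) p = (\<Sum>k\<in>I. c k * b k p)"
      by (simp add: sum_apply word_scale_def)
    also have "\<dots> = \<Phi> c p"
      by (simp add: b \<Phi>_def biform_def I_def[symmetric] sum_distrib_left mult_ac cong: sum.cong)
    finally show "\<Phi> c p = (\<Sum>k\<in>I. word_scale (c k) (b k)) p" ..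
  qed
  have weight: "card {p \<in> X. \<Phi> c p \<noteq> 0} = card {x. biform c x \<noteq> 0}" for c
  proof -
    have "bij_betw \<theta> {p \<in> X. \<Phi> c p \<noteq> 0} {x. biform c x \<noteq> 0}"
      using \<theta> \<nu> unfolding bij_betw_def inj_on_def by (auto simp: \<Phi>_def image_iff) (metis UNIV_I imageE)
    then show ?thesis by (rule bij_betw_same_card)
  qed
  \<comment> \<open>The weight bound is positive, so only zero coefficients give the zero word; the
    dimension therefore follows from the same bound as the distance.\<close>
  have nonzero: "\<forall>k\<in>I. c k = 0" if "\<Phi> c = 0" for c
  proof (rule ccontr)
    assume "\<not> ?thesis"
    then have "card {p \<in> X. \<Phi> c p \<noteq> 0} \<ge> (CARD('a) - 1)\<^sup>2"
      unfolding weight I_def using biform_weight by blast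
    moreover have "(CARD('a) - 1)\<^sup>2 > 0"
      using card by simp
    ultimately show False
      using that by simp
  qed
  \<comment> \<open>Independence concerns the set of words, so coincidences must be excluded first:
    equal words would make a family with entries 1 and -1 give the zero word.\<close>
  have inj_b: "inj_on b I"
  proof (rule inj_onI, rule ccontr)
    fix k l assume kl: "k \<in> I" "l \<in> I" "b k = b l" "k \<noteq> l"
    then have "\<Phi> (\<lambda>j. (if j = k then 1 else 0) - (if j = l then 1 else 0)) = 0"
      by (auto simp: fun_eq_iff b_def simp flip: diff)
    from nonzero[OF this] kl show False
      by (metis (full_types) diff_zero zero_neq_one)
  qed
  have independent: "word.independent (b ` I)"
  proof
    assume "word.dependent (b ` I)"
    then obtain u where u: "(\<Sum>v\<in>b ` I. word_scale (u v) v) = 0" "\<exists>v\<in>b ` I. u v \<noteq> 0"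
      using I by (auto simp: word.dependent_finite)
    then have "\<Phi> (u \<circ> b) = 0"
      by (simp add: expand sum.reindex[OF inj_b])
    with u nonzero[of "u \<circ> b"] show False by auto
  qed
  have subspace: "word.subspace (range \<Phi>)"
  proof -
    have "\<Phi> (\<lambda>_. 0) = 0" "\<Phi> c + \<Phi> d = \<Phi> (\<lambda>k. c k + d k)" "word_scale a (\<Phi> c) = \<Phi> (\<lambda>k. a * c k)" for a c d
      by (simp_all only: expand word.scale_left_distrib sum.distrib word.scale_sum_right
          word.scale_scale word.scale_zero_left sum.neutral_const)
    then show ?thesis
      by (intro word.subspaceI) (auto intro: range_eqI[OF sym])
  qed
  have "word.span (b ` I) = range \<Phi>"
  proof
    show "word.span (b ` I) \<subseteq> range \<Phi>"
      using subspace by (intro word.span_minimal) (auto simp: b_def)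
    show "range \<Phi> \<subseteq> word.span (b ` I)"
      unfolding expand[abs_def] by (auto intro: word.span_sum word.span_scale word.span_base)
  qed
  then have "word.dim (range \<Phi>) = card (b ` I)"
    using independent subspace by (intro word.dim_eq_card) (simp add: word.span_eq_iff[THEN iffD2])
  then have dim: "word.dim (range \<Phi>) = 9"
    by (simp add: card_image[OF inj_b] I)
  \<comment> \<open>By linearity a distance is the weight of a difference, counted on the product of
    lines through \<open>\<theta>\<close>.\<close>
  have dist: "hamming_dist X (\<Phi> c) (\<Phi> d) = card {x. biform (\<lambda>k. c k - d k) x \<noteq> 0}" for c d
    by (simp add: hamming_dist_def flip: weight diff)
  have "min_dist X (range \<Phi>) = (CARD('a) - 1)\<^sup>2"
    unfolding min_dist_def
  proof (rule Min_eqI)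
    have "hamming_dist X u w \<le> card X" for u w :: "'p \<Rightarrow> 'a"
      unfolding hamming_dist_def using X by (intro card_mono) auto
    then have "{hamming_dist X u w |u w. u \<in> range \<Phi> \<and> w \<in> range \<Phi> \<and> u \<noteq> w} \<subseteq> {..card X}"
      by blast
    then show "finite {hamming_dist X u w |u w. u \<in> range \<Phi> \<and> w \<in> range \<Phi> \<and> u \<noteq> w}"
      by (rule finite_subset) simp
  next
    fix d assume "d \<in> {hamming_dist X u w |u w. u \<in> range \<Phi> \<and> w \<in> range \<Phi> \<and> u \<noteq> w}"
    then obtain c c' where c: "d = hamming_dist X (\<Phi> c) (\<Phi> c')" "\<Phi> c \<noteq> \<Phi> c'"
      by auto
    have "\<exists>k\<in>I. c k - c' k \<noteq> 0"
    proof (rule ccontr)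
      assume "\<not> ?thesis"
      then have "\<Phi> c = \<Phi> c'"
        unfolding expand by (intro sum.cong) auto
      with c show False by simp
    qed
    then obtain k where "k \<in> I" "c k - c' k \<noteq> 0" ..
    then show "(CARD('a) - 1)\<^sup>2 \<le> d"
      unfolding c dist I_def using biform_weight[of k "\<lambda>k. c k - c' k"] by simp
  next
    \<comment> \<open>The word of s0 s1 t0 t1, compared with the zero word, attains the
      bound.\<close>
    let ?c = "\<lambda>k :: nat \<times> nat. if k = (1, 1) then 1 else (0::'a)"
    have "(1, 1) \<in> I"
      by (simp add: I_def)
    then have "\<Phi> ?c \<noteq> 0"
      using nonzero[of ?c] by fastforce
    moreover have "\<Phi> (\<lambda>_. 0) = 0"
      by (simp add: expand)
    moreover have "hamming_dist X (\<Phi> ?c) (\<Phi> (\<lambda>_. 0)) = (CARD('a) - 1)\<^sup>2"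
      unfolding dist using biform_weight_attained[where 'a = 'a] by simp
    ultimately show "(CARD('a) - 1)\<^sup>2 \<in> {hamming_dist X u w |u w. u \<in> range \<Phi> \<and> w \<in> range \<Phi> \<and> u \<noteq> w}"
      by (intro CollectI exI[of _ "\<Phi> ?c"] exI[of _ "\<Phi> (\<lambda>_. 0)"]) simp
  qed
  moreover have "range \<Phi> \<subseteq> words_on X"
    by (auto simp: words_on_def \<Phi>_def)
  moreover have "card X = (CARD('a) + 1)\<^sup>2"
    using bij_betw_same_card[OF \<theta>] by (simp add: power2_eq_square)
  moreover have "range (\<lambda>c p. if p \<in> X then \<nu> p * biform c (\<theta> p) else 0) = range \<Phi>"
    by (simp add: \<Phi>_def[abs_def])
  ultimately show ?thesis
    unfolding is_code_def using X subspace dim by simp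
qed

subsection \<open>The Segre parametrization of the hyperbolic quadric\<close>

text \<open>\<open>row_ix\<close> and \<open>col_ix\<close> are the exponents of s1 and t1 in the
  coordinates s0 t0, s0 t1, s1 t0, s1 t1 of the Segre map.\<close>

definition row_ix :: "4 \<Rightarrow> nat" where "row_ix i = (if i = 3 \<or> i = 4 then 1 else 0)"
definition col_ix :: "4 \<Rightarrow> nat" where "col_ix i = (if i = 2 \<or> i = 4 then 1 else 0)"

definition segre :: "'a::field option \<times> 'a option \<Rightarrow> 'a ^ 4"
  where "segre x = (\<chi> i. line_monom 1 (row_ix i) (fst x) * line_monom 1 (col_ix i) (snd x))"

lemma segre_nth:
  "segre x $ 1 = line_monom 1 0 (fst x) * line_monom 1 0 (snd x)"
  "segre x $ 2 = line_monom 1 0 (fst x) * line_monom 1 1 (snd x)"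
  "segre x $ 3 = line_monom 1 1 (fst x) * line_monom 1 0 (snd x)"
  "segre x $ 4 = line_monom 1 1 (fst x) * line_monom 1 1 (snd x)"
  by (simp_all add: segre_def row_ix_def col_ix_def)

lemma segre_on_quadric: "segre x $ 1 * segre x $ 4 - segre x $ 2 * segre x $ 3 = 0"
  by (simp add: segre_nth)

lemma exists_4: "(\<exists>i::4. P i) \<longleftrightarrow> P 1 \<or> P 2 \<or> P 3 \<or> P 4"
  by (metis exhaust_4)

lemma segre_nonzero: "segre x \<noteq> 0"
proof -
  have "\<exists>i. segre x $ i \<noteq> 0"
    by (cases "fst x"; cases "snd x") (simp_all add: exists_4 segre_nth line_monom_def)
  then show ?thesis
    by auto
qed

text \<open>This is injectivity into projective space. In the order 1, 2, 3, 4 the first nonzero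
  coordinate of a Segre vector is 1, which forces \<open>c = 1\<close>.\<close>

lemma segre_inj:
  assumes "segre x = c *s segre y"
  shows "x = y"
proof -
  have "\<forall>i. segre x $ i = c * segre y $ i"
    using assms by simp
  then show ?thesis
    by (cases x; cases y; cases "fst x"; cases "snd x"; cases "fst y"; cases "snd y")
      (auto simp: forall_4 segre_nth line_monom_def)
qed

lemma segre_nth_mult:
  "segre x $ i * segre x $ j =
    line_monom 2 (row_ix i + row_ix j) (fst x) * line_monom 2 (col_ix i + col_ix j) (snd x)"
proof -
  have ix: "row_ix i \<le> 1" "col_ix i \<le> 1" for i
    by (auto simp: row_ix_def col_ix_def)
  have "segre x $ i * segre x $ j = (line_monom 1 (row_ix i) (fst x) * line_monom 1 (row_ix j) (fst x)) *
      (line_monom 1 (col_ix i) (snd x) * line_monom 1 (col_ix j) (snd x))"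
    by (simp add: segre_def mult_ac)
  also have "\<dots> = line_monom (1 + 1) (row_ix i + row_ix j) (fst x) * line_monom (1 + 1) (col_ix i + col_ix j) (snd x)"
    by (simp only: line_monom_mult ix)
  finally show ?thesis
    by (simp only: one_add_one)
qed

lemma quadratic_function_segre:
  assumes "quadratic_function G"
  obtains c where "\<And>x. G (segre x) = biform c x"
proof -
  obtain a where a: "G = (\<lambda>v. \<Sum>i\<in>UNIV. \<Sum>j\<in>UNIV. a i j * (v $ i * v $ j))"
    using assms by (auto simp: quadratic_function_def)
  define e where "e = (\<lambda>(i, j). (row_ix i + row_ix j, col_ix i + col_ix j))"
  define I :: "(nat \<times> nat) set" where "I = {..2} \<times> {..2}"
  have e: "e ij \<in> I" for ij
    by (cases ij) (auto simp: e_def I_def row_ix_def col_ix_def)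
  \<comment> \<open>Different coordinate pairs can restrict to the same monomial, as y1 y4 and y2 y3
    do, so coefficients are summed over the fibres of \<open>e\<close>.\<close>
  have "G (segre x) = biform (\<lambda>k. \<Sum>ij\<in>UNIV. if k = e ij then case_prod a ij else 0) x" for x
  proof -
    define m where "m k = line_monom 2 (fst k) (fst x) * line_monom 2 (snd k) (snd x)" for k
    have "G (segre x) = (\<Sum>ij\<in>UNIV. case_prod a ij * m (e ij))"
      by (simp add: a segre_nth_mult sum.cartesian_product m_def e_def case_prod_beta)
    also have "\<dots> = (\<Sum>ij\<in>UNIV. \<Sum>k\<in>I. if k = e ij then case_prod a ij * m k else 0)"
      using e by (simp add: I_def sum.delta)
    also have "\<dots> = (\<Sum>k\<in>I. \<Sum>ij\<in>UNIV. if k = e ij then case_prod a ij * m k else 0)"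
      by (rule sum.swap)
    also have "\<dots> = (\<Sum>k\<in>I. (\<Sum>ij\<in>UNIV. if k = e ij then case_prod a ij else 0) * m k)"
      unfolding sum_distrib_right by (intro sum.cong refl) simp
    finally show ?thesis
      by (simp only: biform_def m_def I_def)
  qed
  then show ?thesis
    by (rule that)
qed

lemma biform_is_quadratic:
  fixes c :: "nat \<times> nat \<Rightarrow> 'a::field"
  obtains G where "quadratic_function G" "\<And>x. G (segre x) = biform c x"
proof -
  \<comment> \<open>Each of the nine exponent pairs is realised by a product of two Segre
    coordinates, so restriction is surjective.\<close>
  have "\<exists>i j. k = (row_ix i + row_ix j, col_ix i + col_ix j)" if "k \<in> {..2} \<times> {..2}" for k
    using that by (cases k) (auto simp: exists_4 row_ix_def col_ix_def le_Suc_eq numeral_2_eq_2)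
  then obtain i j where ij: "k = (row_ix (i k) + row_ix (j k), col_ix (i k) + col_ix (j k))"
    if "k \<in> {..2} \<times> {..2}" for k
    by metis
  show ?thesis
  proof
    show "quadratic_function (\<lambda>v. \<Sum>k\<in>{..2} \<times> {..2}. c k * (v $ i k * v $ j k))"
      by (intro quadratic_function_sum quadratic_function_monomial)
    show "(\<Sum>k\<in>{..2} \<times> {..2}. c k * (segre x $ i k * segre x $ j k)) = biform c x" for x
      unfolding biform_def by (intro sum.cong refl) (metis ij segre_nth_mult fst_conv snd_conv)
  qed
qed

section \<open>Normalised representatives and transfer of the code to the quadric\<close>

lemma coord_rep_span:
  fixes v :: "'a::field ^ 4"
  assumes "v \<noteq> 0"
  obtains c where "c \<noteq> 0" "coord_rep (vec.span {v}) = c *s v"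
proof -
  define i where "i = (LEAST i. v $ i \<noteq> 0)"
  have "\<exists>i. v $ i \<noteq> 0"
    using assms by (auto simp: vec_eq_iff)
  then have i: "v $ i \<noteq> 0" "\<And>j. j < i \<Longrightarrow> v $ j = 0"
    unfolding i_def by (rule LeastI_ex) (use not_less_Least in blast)
  have "coord_rep (vec.span {v}) = (1 / v $ i) *s v"
    unfolding coord_rep_def
  proof (rule the_equality)
    show "(1 / v $ i) *s v \<in> vec.span {v} \<and> (\<exists>k. ((1 / v $ i) *s v) $ k = 1 \<and> (\<forall>j<k. ((1 / v $ i) *s v) $ j = 0))"
      using i by (intro conjI exI[of _ i]) (auto simp: vec.span_singleton)
  next
    fix w assume w: "w \<in> vec.span {v} \<and> (\<exists>k. w $ k = 1 \<and> (\<forall>j<k. w $ j = 0))"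
    then obtain a where "w = a *s v"
      by (auto simp: vec.span_singleton)
    with w obtain k where a: "w = a *s v" "a * v $ k = 1" "\<And>j. j < k \<Longrightarrow> a * v $ j = 0"
      by (metis vector_smult_component)
    then have "a \<noteq> 0" "v $ k \<noteq> 0" by auto
    \<comment> \<open>Nonzero multiples have the same leading position, so the normalised multiple
      is unique.\<close>
    with a(3) i have "k = i"
      by (metis linorder_neqE mult_eq_0_iff)
    with a i show "w = (1 / v $ i) *s v"
      by (simp add: field_simps)
  qed
  with i(1) show ?thesis
    using that[of "1 / v $ i"] by simp
qed

theorem theorem6p2:
  fixes X :: "('a::{field,finite}) point3 set" and q :: nat
  assumes "q = CARD('a)" and "q \<ge> 3"
    and "hyperbolic_quadric X"
  shows "is_code X (functional_code 2 X) ((q + 1)\<^sup>2) 9 ((q - 1)\<^sup>2)"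
proof -
  obtain f :: "'a poly4" where f: "is_form 2 f" "form_rank f = 4" and X: "X = zero_set f"
    and card: "card X = (CARD('a) + 1)\<^sup>2"
    using assms(3) by (auto simp: hyperbolic_quadric_def nondegenerate_quadric_def)
  obtain N :: "'a ^ 4 ^ 4" where N: "invertible N" "\<And>y. eval4 f (N *v y) = y $ 1 * y $ 4 - y $ 2 * y $ 3"
    using hyperbolic_normal_form[OF f] card X by blast
  obtain M where M: "M ** N = mat 1" "N ** M = mat 1"
    using N(1) by (auto simp: invertible_def)
  have MN: "M *v (N *v y) = y" for y
    by (simp add: matrix_vector_mul_assoc M)
  \<comment> \<open>The Segre map followed by \<open>N\<close> lands in \<open>X\<close> by the
    normal form; being injective between sets of size (q + 1)^2, it is onto.\<close>
  define pt where "pt x = vec.span {N *v segre x}" for x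
  have nz: "N *v segre x \<noteq> 0" for x
    using MN[of "segre x"] segre_nonzero[of x] by (metis matrix_vector_mult_0_right)
  have pt_inj: "inj pt"
  proof (rule injI)
    fix x y assume "pt x = pt y"
    then have "N *v segre x \<in> vec.span {N *v segre y}"
      by (metis pt_def vec.span_base singletonI)
    then obtain c where "N *v segre x = c *s (N *v segre y)"
      by (auto simp: vec.span_singleton)
    then have "segre x = c *s segre y"
      by (metis MN vector_scalar_commute)
    then show "x = y" by (rule segre_inj)
  qed
  have "range pt \<subseteq> X"
    by (auto simp: pt_def X zero_set_span_iff[OF f(1) nz] N(2) segre_on_quadric)
  moreover have "card (range pt) = card X"
    using pt_inj by (simp add: card_image card power2_eq_square)
  ultimately have "range pt = X"
    by (intro card_subset_eq) auto
  define \<theta> where "\<theta> = the_inv pt"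
  have \<theta>: "bij_betw \<theta> X UNIV" and pt_\<theta>: "\<And>p. p \<in> X \<Longrightarrow> pt (\<theta> p) = p"
    unfolding \<theta>_def using pt_inj \<open>range pt = X\<close>
    by (auto simp: f_the_inv_into_f intro: bij_betw_the_inv_into bij_betw_imageI)
  have "\<exists>c. c \<noteq> 0 \<and> coord_rep p = c *s (N *v segre (\<theta> p))" if "p \<in> X" for p
    using coord_rep_span[OF nz] pt_\<theta>[OF that] unfolding pt_def by metis
  then obtain \<mu> where \<mu>: "\<And>p. p \<in> X \<Longrightarrow> \<mu> p \<noteq> 0 \<and> coord_rep p = \<mu> p *s (N *v segre (\<theta> p))"
    by metis
  \<comment> \<open>The normalised representative differs from
    \<open>N *v segre (\<theta> p)\<close> by the factor \<open>\<mu> p\<close>, whose square is the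
    nowhere zero factor in the code of biquadratic forms.\<close>
  have code_map: "code_map X g = (\<lambda>p. if p \<in> X then (\<mu> p)\<^sup>2 * eval4 g (N *v segre (\<theta> p)) else 0)"
    if "is_form 2 g" for g
    using \<mu> quadratic_function_scale[OF quadratic_function_eval4[OF that]]
    by (auto simp: code_map_def fun_eq_iff)
  have "functional_code 2 X = range (\<lambda>c p. if p \<in> X then (\<mu> p)\<^sup>2 * biform c (\<theta> p) else 0)"
  proof (intro equalityI subsetI)
    fix w assume "w \<in> functional_code 2 X"
    then obtain g where g: "is_form 2 g" "w = code_map X g"
      by (auto simp: functional_code_def)
    obtain c where c: "\<And>x. eval4 (lin_subst N g) (segre x) = biform c x"
      using quadratic_function_segre[OF quadratic_function_eval4[OF is_form_lin_subst[OF g(1)]]] by blast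
    show "w \<in> range (\<lambda>c p. if p \<in> X then (\<mu> p)\<^sup>2 * biform c (\<theta> p) else 0)"
      unfolding g(2) code_map[OF g(1)] eval4_lin_subst[symmetric] c by (rule rangeI)
  next
    fix w assume "w \<in> range (\<lambda>c p. if p \<in> X then (\<mu> p)\<^sup>2 * biform c (\<theta> p) else 0)"
    then obtain c where c: "w = (\<lambda>p. if p \<in> X then (\<mu> p)\<^sup>2 * biform c (\<theta> p) else 0)"
      by auto
    obtain G where G: "quadratic_function G" "\<And>x. G (segre x) = biform c x"
      by (rule biform_is_quadratic[of c]) blast
    obtain h where h: "is_form 2 h" "eval4 h = G"
      using quadratic_function_is_form[OF G(1)] .
    \<comment> \<open>Substituting the inverse matrix \<open>M\<close> cancels \<open>N\<close>,
      leaving the values of \<open>G\<close> on Segre vectors.\<close>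
    have "w = code_map X (lin_subst M h)"
      unfolding code_map[OF is_form_lin_subst[OF h(1)]] c eval4_lin_subst MN h(2) G(2) ..
    then show "w \<in> functional_code 2 X"
      unfolding functional_code_def using is_form_lin_subst[OF h(1)] by blast
  qed
  moreover have "is_code X (range (\<lambda>c p. if p \<in> X then (\<mu> p)\<^sup>2 * biform c (\<theta> p) else 0))
      ((CARD('a) + 1)\<^sup>2) 9 ((CARD('a) - 1)\<^sup>2)"
    using assms(1,2) \<theta> \<mu> by (intro biform_code) auto
  ultimately show ?thesis
    using assms(1) by simp
qed

end
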